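(* For every $n\ge1$ and every $(a_1,\ldots,a_n)\in\mathbb{N}^n$, the order dual $P(a_1,\ldots,a_n)^*$ of the poset $P(a_1,\ldots,a_n)$ admits a recursive atom ordering and hence is $\mathrm{CL}$-shellable.
   Context: Here $\mathbb{N}=\{0,1,2,\ldots\}$. For $(a_1,\ldots,a_n),(b_1,\ldots,b_n)\in\mathbb{N}^n$, say that $(a_1,\ldots,a_n)$ properly divides $(b_1,\ldots,b_n)$ if for every $1\le i\le n$ either $a_i=b_i=0$ or $a_i<b_i$. Write $(a_1,\ldots,a_n)\le(b_1,\ldots,b_n)$ if the two are equal or the first properly divides the second; this is a partial order. Let $P(a_1,\ldots,a_n)=\{(b_1,\ldots,b_n)\in\mathbb{N}^n:(b_1,\ldots,b_n)\le(a_1,\ldots,a_n)\}$, ordered by $\le$. It has unique minimal element $(0,\ldots,0)$ and unique maximal element $(a_1,\ldots,a_n)$. $P^*$ denotes the order dual. Let $P$ be a finite poset with unique minimal element $\widehat 0$ and unique maximal element $\widehat 1$. Its atoms are the elements covering $\widehat 0$; its length $\ell(P)$ is the maximal length (number of elements minus one) of its chains. Recursive definition: $P$ admits a recursive atom ordering if $\ell(P)\le 1$, or $\ell(P)>1$ and there is a linear ordering $\preceq$ of the atoms of $P$ such that: (i) for all atoms $p$ of $P$, the interval $[p,\widehat 1]$ admits a recursive atom ordering in which the atoms of $[p,\widehat 1]$ that belong to $[q,\widehat 1]$ for some atom $q\prec p$ come first; (ii) for all atoms $p\prec p'$ and all elements $q$ of $P$ with $p,p'<q$, there exist an atom $p''\prec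 p'$ of $P$ and an atom $q'$ of $[p',\widehat 1]$ such that $p''<q'\le q$. $\mathrm{CL}$-shellability (non-pure version of Björner and Wachs): a chain-edge labeling of $P$ assigns to each pair $(m,e)$, with $m$ a maximal chain of $P$ and $e$ a cover relation in $m$, an element $\lambda(m,e)$ of some poset $\Lambda$, such that if two maximal chains coincide along their first $d$ cover relations (starting from $\widehat 0$), then their labels coincide along these $d$ cover relations. A rooted interval $[x,y]_r$ is an interval $[x,y]$ together with a maximal chain $r$ of $[\widehat 0,x]$; every maximal chain $c$ of $[x,y]$ then has a well-defined label sequence, read off from any maximal chain of $P$ containing $r\cup c$. The labeling is a $\mathrm{CL}$-labeling if in every rooted interval $[x,y]_r$ there is a unique maximal chain whose label sequence is strictly increasing, and the label sequence of this chain lexicographically precedes the label sequences of all other maximal chains of $[x,y]_r$. $P$ is $\mathrm{CL}$-shellable if it admits a $\mathrm{CL}$-labeling. *)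

theory Defs
  imports Main
begin

text \<open>
  A poset is its order relation r (a set of pairs, with carrier Field r); its order dual is the
  converse r\<inverse>, and the strict order is r - Id. Elements of N^n are lists of length n.
\<close>

definition properly_divides :: "nat list \<Rightarrow> nat list \<Rightarrow> bool" where
  "properly_divides a b \<longleftrightarrow> list_all2 (\<lambda>x y. (x = 0 \<and> y = 0) \<or> x < y) a b"

definition vec_le :: "nat list \<Rightarrow> nat list \<Rightarrow> bool" where
  "vec_le a b \<longleftrightarrow> a = b \<or> properly_divides a b"

definition P_order :: "nat list \<Rightarrow> nat list rel" where
  "P_order a = {(b, c). vec_le b a \<and> vec_le c a \<and> vec_le b c}"

definition minimal_elt :: "'a rel \<Rightarrow> 'a \<Rightarrow> bool" where
  "minimal_elt r z \<longleftrightarrow> z \<in> Field r \<and> (\<forall>x. (x, z) \<in> r \<longrightarrow> x = z)"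

definition maximal_elt :: "'a rel \<Rightarrow> 'a \<Rightarrow> bool" where
  "maximal_elt r z \<longleftrightarrow> z \<in> Field r \<and> (\<forall>x. (z, x) \<in> r \<longrightarrow> x = z)"

definition finite_bounded_poset :: "'a rel \<Rightarrow> bool" where
  "finite_bounded_poset r \<longleftrightarrow> finite (Field r) \<and> partial_order_on (Field r) r \<and>
     (\<exists>!z. minimal_elt r z) \<and> (\<exists>!z. maximal_elt r z)"

definition hat0 :: "'a rel \<Rightarrow> 'a" where
  "hat0 r = (THE z. minimal_elt r z)"

definition hat1 :: "'a rel \<Rightarrow> 'a" where
  "hat1 r = (THE z. maximal_elt r z)"

definition covered_by :: "'a rel \<Rightarrow> 'a \<Rightarrow> 'a \<Rightarrow> bool" where
  "covered_by r x y \<longleftrightarrow> (x, y) \<in> r - Id \<and> \<not> (\<exists>z. (x, z) \<in> r - Id \<and> (z, y) \<in> r - Id)"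

definition atoms :: "'a rel \<Rightarrow> 'a set" where
  "atoms r = {p. covered_by r (hat0 r) p}"

definition interval :: "'a rel \<Rightarrow> 'a \<Rightarrow> 'a \<Rightarrow> 'a rel" where
  "interval r x y = Restr r {z. (x, z) \<in> r \<and> (z, y) \<in> r}"

definition poset_length :: "'a rel \<Rightarrow> nat" where
  "poset_length r = Max ((\<lambda>C. card C - 1) ` Chains r)"

text \<open>
  The linear ordering L of the atoms is a recursive atom ordering of the bounded poset r. The
  recursion of the definition is well-founded, because the length drops strictly from r to
  [p, 1]; hence the least fixed point is the only one. If the length is at most 1, there is at
  most one atom, and its only linear ordering is accepted.
\<close>

inductive recursive_atom_ordering :: "'a rel \<Rightarrow> 'a rel \<Rightarrow> bool" where
  short:
    "recursive_atom_ordering r L"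
    if "poset_length r \<le> 1"
      and "linear_order_on (atoms r) L"
| long:
    "recursive_atom_ordering r L"
    if "poset_length r > 1"
      and "linear_order_on (atoms r) L"
      and "\<forall>p \<in> atoms r. \<exists>L'. recursive_atom_ordering (interval r p (hat1 r)) L' \<and>
             (\<forall>s \<in> atoms (interval r p (hat1 r)). \<forall>t \<in> atoms (interval r p (hat1 r)).
                (\<exists>q. (q, p) \<in> L - Id \<and> s \<in> Field (interval r q (hat1 r))) \<and>
                \<not> (\<exists>q. (q, p) \<in> L - Id \<and> t \<in> Field (interval r q (hat1 r)))
                \<longrightarrow> (s, t) \<in> L')"
      and "\<forall>p p' q. (p, p') \<in> L - Id \<and> (p, q) \<in> r - Id \<and> (p', q) \<in> r - Id \<longrightarrow>
             (\<exists>p'' q'. (p'', p') \<in> L - Id \<and> q' \<in> atoms (interval r p' (hat1 r)) \<and>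
                (p'', q') \<in> r - Id \<and> (q', q) \<in> r)"

definition admits_recursive_atom_ordering :: "'a rel \<Rightarrow> bool" where
  "admits_recursive_atom_ordering r \<longleftrightarrow>
     finite_bounded_poset r \<and> (\<exists>L. recursive_atom_ordering r L)"

text \<open>A finite chain is represented by the list of its elements in increasing order.\<close>

definition maximal_chain :: "'a rel \<Rightarrow> 'a list \<Rightarrow> bool" where
  "maximal_chain r m \<longleftrightarrow> sorted_wrt (\<lambda>x y. (x, y) \<in> r - Id) m \<and> set m \<in> Chains r \<and>
     (\<forall>C \<in> Chains r. set m \<subseteq> C \<longrightarrow> C = set m)"

text \<open>The consecutive pairs; for a maximal chain these are its cover relations.\<close>

definition edges :: "'a list \<Rightarrow> ('a \<times> 'a) list" where
  "edges m = zip m (tl m)"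

definition chain_edge_labeling ::
  "'a rel \<Rightarrow> 'l rel \<Rightarrow> ('a list \<Rightarrow> 'a \<times> 'a \<Rightarrow> 'l) \<Rightarrow> bool" where
  "chain_edge_labeling r \<Lambda> lam \<longleftrightarrow>
     (\<forall>m. maximal_chain r m \<longrightarrow> (\<forall>e \<in> set (edges m). lam m e \<in> Field \<Lambda>)) \<and>
     (\<forall>m m' d. maximal_chain r m \<and> maximal_chain r m' \<and>
        d \<le> length (edges m) \<and> d \<le> length (edges m') \<and> take d (edges m) = take d (edges m')
        \<longrightarrow> (\<forall>e \<in> set (take d (edges m)). lam m e = lam m' e))"

text \<open>
  The label sequence of a maximal chain c of the rooted interval with root rt, read off from
  any maximal chain containing both; for a chain-edge labeling the choice is immaterial.
\<close>

definition label_seq ::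
  "'a rel \<Rightarrow> ('a list \<Rightarrow> 'a \<times> 'a \<Rightarrow> 'l) \<Rightarrow> 'a list \<Rightarrow> 'a list \<Rightarrow> 'l list" where
  "label_seq r lam rt c =
     map (lam (SOME m. maximal_chain r m \<and> set rt \<union> set c \<subseteq> set m)) (edges c)"

definition CL_labeling ::
  "'a rel \<Rightarrow> 'l rel \<Rightarrow> ('a list \<Rightarrow> 'a \<times> 'a \<Rightarrow> 'l) \<Rightarrow> bool" where
  "CL_labeling r \<Lambda> lam \<longleftrightarrow>
     partial_order_on (Field \<Lambda>) \<Lambda> \<and> chain_edge_labeling r \<Lambda> lam \<and>
     (\<forall>x y rt. (x, y) \<in> r \<and> maximal_chain (interval r (hat0 r) x) rt \<longrightarrow>
        (\<exists>c. maximal_chain (interval r x y) c \<and>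
             sorted_wrt (\<lambda>k l. (k, l) \<in> \<Lambda> - Id) (label_seq r lam rt c) \<and>
             (\<forall>c'. maximal_chain (interval r x y) c' \<and> c' \<noteq> c \<longrightarrow>
                \<not> sorted_wrt (\<lambda>k l. (k, l) \<in> \<Lambda> - Id) (label_seq r lam rt c') \<and>
                (label_seq r lam rt c, label_seq r lam rt c') \<in> lexord (\<Lambda> - Id))))"

text \<open>
  HOL cannot quantify over the type of labels. Fixing it to be nat loses nothing, since a finite
  poset uses only finitely many labels: the last lemma of this theory has an arbitrary
  label type.
\<close>

definition CL_shellable :: "'a rel \<Rightarrow> bool" where
  "CL_shellable r \<longleftrightarrow>
     finite_bounded_poset r \<and>
     (\<exists>(\<Lambda> :: nat rel) (lam :: 'a list \<Rightarrow> 'a \<times> 'a \<Rightarrow> nat). CL_labeling r \<Lambda> lam)"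

lemma lexord_map:
  assumes "(u, v) \<in> lexord R" and "set u \<subseteq> S" and "set v \<subseteq> S"
    and "\<And>a b. a \<in> S \<Longrightarrow> b \<in> S \<Longrightarrow> (a, b) \<in> R \<Longrightarrow> (f a, f b) \<in> R'"
  shows "(map f u, map f v) \<in> lexord R'"
proof -
  consider (prefix) a w where "v = u @ a # w"
    | (diff) x a b w w' where "(a, b) \<in> R" "u = x @ a # w" "v = x @ b # w'"
    using assms(1) unfolding lexord_def by blast
  then show ?thesis
  proof cases
    case prefix
    then show ?thesis by (auto simp: lexord_def)
  next
    case diff
    then have "(f a, f b) \<in> R'" using assms by auto
    then have "\<exists>x a b w w'. (a, b) \<in> R' \<and> map f u = x @ a # w \<and> map f v = x @ b # w'"
      using diff by (intro exI[of _ "map f x"] exI[of _ "f a"] exI[of _ "f b"]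
          exI[of _ "map f w"] exI[of _ "map f w'"]) simp
    then show ?thesis unfolding lexord_def by blast
  qed
qed

lemma maximal_chain_in:
  assumes "maximal_chain r m"
  shows "m \<in> {xs. set xs \<subseteq> Field r \<and> distinct xs}"
proof -
  have "set m \<subseteq> Field r"
    using assms by (auto simp: maximal_chain_def Chains_def Field_def)
  moreover have "distinct m" if "sorted_wrt (\<lambda>x y. (x, y) \<in> r - Id) m"
    using that by (induction m) auto
  ultimately show ?thesis using assms by (simp add: maximal_chain_def)
qed

lemma CL_shellableI:
  fixes lam :: "'a list \<Rightarrow> 'a \<times> 'a \<Rightarrow> 'l"
  assumes r: "finite_bounded_poset r" and CL: "CL_labeling r \<Lambda> lam"
  shows "CL_shellable r"
proof -
  define D where "D = {xs. set xs \<subseteq> Field r \<and> distinct xs}"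
  define S where "S = (\<Union>m\<in>D. lam m ` set (edges m)) \<union>
    (\<Union>rt\<in>D. \<Union>c\<in>D. set (label_seq r lam rt c))"
  have "finite (Field r)" using r by (simp add: finite_bounded_poset_def)
  then have "finite D" unfolding D_def by (simp add: finite_subset_distinct)
  then have "finite S" unfolding S_def by auto
  then obtain f :: "'l \<Rightarrow> nat" where f: "inj_on f S"
    using finite_imp_inj_to_nat_seg by blast
  define \<Lambda>' where "\<Lambda>' = {(f a, f b) | a b. a \<in> S \<and> b \<in> S \<and> (a, b) \<in> \<Lambda>}"
  define lam' where "lam' = (\<lambda>m e. f (lam m e))"
  have po: "partial_order_on (Field \<Lambda>) \<Lambda>" and cel: "chain_edge_labeling r \<Lambda> lam"
    using CL by (auto simp: CL_labeling_def)
  have rel: "(f a, f b) \<in> \<Lambda>' \<longleftrightarrow> (a, b) \<in> \<Lambda>" if "a \<in> S" "b \<in> S" for a b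
    using that f unfolding \<Lambda>'_def by (auto dest: inj_onD)
  have rel': "(f a, f b) \<in> \<Lambda>' - Id \<longleftrightarrow> (a, b) \<in> \<Lambda> - Id" if "a \<in> S" "b \<in> S" for a b
    using that f rel by (auto dest: inj_onD)
  have refl: "(a, a) \<in> \<Lambda>" if "a \<in> Field \<Lambda>" for a
    using po that by (auto simp: order_on_defs refl_on_def)
  have po': "partial_order_on (Field \<Lambda>') \<Lambda>'"
  proof -
    have "\<Lambda>' \<subseteq> Field \<Lambda>' \<times> Field \<Lambda>'" by (auto simp: Field_def)
    moreover have "refl_on (Field \<Lambda>') \<Lambda>'"
      unfolding refl_on_def
    proof
      fix k assume "k \<in> Field \<Lambda>'"
      then obtain a where "k = f a" "a \<in> S" "a \<in> Field \<Lambda>"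
        unfolding \<Lambda>'_def Field_def by auto
      then show "(k, k) \<in> \<Lambda>'" using refl rel by auto
    qed
    moreover have "trans \<Lambda>'"
    proof (rule transI)
      fix j k l assume "(j, k) \<in> \<Lambda>'" "(k, l) \<in> \<Lambda>'"
      then obtain a b b' c where *: "j = f a" "k = f b" "k = f b'" "l = f c"
        "a \<in> S" "b \<in> S" "b' \<in> S" "c \<in> S" "(a, b) \<in> \<Lambda>" "(b', c) \<in> \<Lambda>"
        unfolding \<Lambda>'_def by auto
      then have "b = b'" using f by (auto dest: inj_onD)
      then have "(a, c) \<in> \<Lambda>" using * po by (auto simp: order_on_defs dest: transD)
      then show "(j, l) \<in> \<Lambda>'" using * rel by auto
    qed
    moreover have "antisym \<Lambda>'"
    proof (rule antisymI)
      fix j k assume jk: "(j, k) \<in> \<Lambda>'" "(k, j) \<in> \<Lambda>'"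
      then obtain a b where *: "j = f a" "k = f b" "a \<in> S" "b \<in> S"
        unfolding \<Lambda>'_def by auto
      then have "(a, b) \<in> \<Lambda>" "(b, a) \<in> \<Lambda>" using jk rel by auto
      then have "a = b" using po by (auto simp: order_on_defs dest: antisymD)
      then show "j = k" using * by simp
    qed
    ultimately show ?thesis by (simp add: order_on_defs)
  qed
  have mD: "m \<in> D" if "maximal_chain r m" for m
    using maximal_chain_in[OF that] by (simp add: D_def)
  have iD: "m \<in> D" if "maximal_chain (interval r x y) m" for m x y
  proof -
    have "Field (interval r x y) \<subseteq> Field r" by (auto simp: interval_def Field_def)
    then show ?thesis using maximal_chain_in[OF that] by (auto simp: D_def)
  qed
  have cel': "chain_edge_labeling r \<Lambda>' lam'"
    unfolding chain_edge_labeling_def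
  proof (intro conjI allI impI ballI)
    fix m e assume m: "maximal_chain r m" and e: "e \<in> set (edges m)"
    then have "lam m e \<in> S" "lam m e \<in> Field \<Lambda>"
      using mD cel unfolding S_def chain_edge_labeling_def by auto
    then have "(f (lam m e), f (lam m e)) \<in> \<Lambda>'" using refl rel by auto
    then show "lam' m e \<in> Field \<Lambda>'" by (auto simp: lam'_def Field_def)
  next
    fix m m' d e
    assume "maximal_chain r m \<and> maximal_chain r m' \<and>
        d \<le> length (edges m) \<and> d \<le> length (edges m') \<and> take d (edges m) = take d (edges m')"
      and "e \<in> set (take d (edges m))"
    then have "lam m e = lam m' e" using cel unfolding chain_edge_labeling_def by blast
    then show "lam' m e = lam' m' e" by (simp add: lam'_def)
  qed
  have ls: "label_seq r lam' rt c = map f (label_seq r lam rt c)" for rt c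
    by (simp add: label_seq_def lam'_def)
  have srt: "sorted_wrt (\<lambda>k l. (k, l) \<in> \<Lambda>' - Id) (map f u) \<longleftrightarrow>
      sorted_wrt (\<lambda>k l. (k, l) \<in> \<Lambda> - Id) u" if "set u \<subseteq> S" for u
  proof -
    have "u ! i \<in> S" if "i < length u" for i using that \<open>set u \<subseteq> S\<close> nth_mem by blast
    then have "(f (u ! i), f (u ! j)) \<in> \<Lambda>' - Id \<longleftrightarrow> (u ! i, u ! j) \<in> \<Lambda> - Id"
      if "i < j" "j < length u" for i j
      using that by (intro rel') auto
    then show ?thesis by (simp add: sorted_wrt_iff_nth_less)
  qed
  have "CL_labeling r \<Lambda>' lam'"
    unfolding CL_labeling_def
  proof (intro conjI po' cel' allI impI)
    fix x y rt assume xy: "(x, y) \<in> r \<and> maximal_chain (interval r (hat0 r) x) rt"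
    obtain c where c: "maximal_chain (interval r x y) c"
      "sorted_wrt (\<lambda>k l. (k, l) \<in> \<Lambda> - Id) (label_seq r lam rt c)"
      and c': "\<And>c'. maximal_chain (interval r x y) c' \<Longrightarrow> c' \<noteq> c \<Longrightarrow>
          \<not> sorted_wrt (\<lambda>k l. (k, l) \<in> \<Lambda> - Id) (label_seq r lam rt c') \<and>
          (label_seq r lam rt c, label_seq r lam rt c') \<in> lexord (\<Lambda> - Id)"
      using CL xy unfolding CL_labeling_def by meson
    have S: "set (label_seq r lam rt d) \<subseteq> S" if "maximal_chain (interval r x y) d" for d
    proof -
      have "rt \<in> D" using iD xy by blast
      moreover have "d \<in> D" using iD that by blast
      ultimately show ?thesis unfolding S_def by blast
    qed
    show "\<exists>c. maximal_chain (interval r x y) c \<and>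
             sorted_wrt (\<lambda>k l. (k, l) \<in> \<Lambda>' - Id) (label_seq r lam' rt c) \<and>
             (\<forall>c'. maximal_chain (interval r x y) c' \<and> c' \<noteq> c \<longrightarrow>
                \<not> sorted_wrt (\<lambda>k l. (k, l) \<in> \<Lambda>' - Id) (label_seq r lam' rt c') \<and>
                (label_seq r lam' rt c, label_seq r lam' rt c') \<in> lexord (\<Lambda>' - Id))"
    proof (intro exI[of _ c] conjI allI impI)
      show "maximal_chain (interval r x y) c" by (rule c)
      show "sorted_wrt (\<lambda>k l. (k, l) \<in> \<Lambda>' - Id) (label_seq r lam' rt c)"
        unfolding ls using srt[OF S[OF c(1)]] c(2) by blast
    next
      fix d assume d: "maximal_chain (interval r x y) d \<and> d \<noteq> c"
      then show "\<not> sorted_wrt (\<lambda>k l. (k, l) \<in> \<Lambda>' - Id) (label_seq r lam' rt d)"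
        unfolding ls using srt[OF S[of d]] c'[of d] by blast
      show "(label_seq r lam' rt c, label_seq r lam' rt d) \<in> lexord (\<Lambda>' - Id)"
        unfolding ls using d c'[of d] S[of c] S[of d] c(1) rel'
        by (intro lexord_map[where S = S and R = "\<Lambda> - Id"]) auto
    qed
  qed
  then show ?thesis using r unfolding CL_shellable_def by blast
qed

end

theory Submission
  imports Defs
begin

text \<open>
  For a nonzero vector x let d be x with every positive entry lowered by one. Every proper divisor
  w of x is componentwise at most d, so every proper divisor of w other than w itself is a proper
  divisor of d and different from d. In the order dual this says that x < w < z implies d < z, with
  d depending on x only. Call such a d a dominant cover of x; it is indeed a cover of x, and every
  element above x that does not cover x lies above d. The rest of the argument takes place in an
  arbitrary finite bounded poset in which all elements but the top have dominant covers.

  \<^emph>\<open>Recursive atom ordering.\<close> Order the atoms in any way that puts the dominant cover d of the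
  bottom first. An element above some other atom p does not cover the bottom, hence it lies above
  d. So all atoms of [p, 1] belong to [d, 1], which makes condition (i) a mere recursive call on
  [p, 1], and d can serve as p'' in condition (ii). This is lemma \<open>recursive_atom_ordering_interval\<close>.

  \<^emph>\<open>CL-shelling.\<close> Label the edge from x to its dominant cover by minus the number of elements y
  with x \<le> y, and every other edge by 0. This label depends on the edge only. Labels on a chain of dominant
  covers increase and are negative, while no label exceeds 0, so a saturated chain is increasing if
  and only if all its edges but possibly the last one are dominant. Since the dominant cover of x
  lies below every y > x that does not cover x, there is exactly one such chain from x to y, and at
  the first edge where another chain leaves it, the other chain has the larger label 0. This is
  lemma \<open>increasing_chain\<close>.
\<close>

section \<open>Posets with dominant covers\<close>

locale dominant_cover_poset =
  fixes r :: "'a rel" and bot top :: 'a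
  assumes finite_Field: "finite (Field r)"
    and partial_order: "partial_order_on (Field r) r"
    and bot_in: "bot \<in> Field r" and bot_least: "\<And>x. x \<in> Field r \<Longrightarrow> (bot, x) \<in> r"
    and top_in: "top \<in> Field r" and top_greatest: "\<And>x. x \<in> Field r \<Longrightarrow> (x, top) \<in> r"
    and dominant: "\<And>x y. (x, y) \<in> r - Id \<Longrightarrow>
      \<exists>d. (x, d) \<in> r - Id \<and> (\<forall>w z. (x, w) \<in> r - Id \<longrightarrow> (w, z) \<in> r - Id \<longrightarrow> (d, z) \<in> r - Id)"
begin

lemma r_refl: "x \<in> Field r \<Longrightarrow> (x, x) \<in> r"
  using partial_order by (auto simp: order_on_defs refl_on_def)

lemma r_trans: "(x, y) \<in> r \<Longrightarrow> (y, z) \<in> r \<Longrightarrow> (x, z) \<in> r"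
  using partial_order by (auto simp: order_on_defs dest: transD)

lemma r_antisym: "(x, y) \<in> r \<Longrightarrow> (y, x) \<in> r \<Longrightarrow> x = y"
  using partial_order by (auto simp: order_on_defs dest: antisymD)

lemma less_le_trans: "(x, y) \<in> r - Id \<Longrightarrow> (y, z) \<in> r \<Longrightarrow> (x, z) \<in> r - Id"
  using r_trans r_antisym by blast

lemma in_Field: "(x, y) \<in> r \<Longrightarrow> x \<in> Field r" "(x, y) \<in> r \<Longrightarrow> y \<in> Field r"
  by (auto simp: Field_def)

definition dom_cover :: "'a \<Rightarrow> 'a" where
  "dom_cover x = (SOME d. (x, d) \<in> r - Id \<and>
     (\<forall>w z. (x, w) \<in> r - Id \<longrightarrow> (w, z) \<in> r - Id \<longrightarrow> (d, z) \<in> r - Id))"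

lemma dom_cover_less: "(x, y) \<in> r - Id \<Longrightarrow> (x, dom_cover x) \<in> r - Id"
  and dom_cover_dominates:
    "(x, w) \<in> r - Id \<Longrightarrow> (w, z) \<in> r - Id \<Longrightarrow> (dom_cover x, z) \<in> r - Id"
proof -
  show "(x, dom_cover x) \<in> r - Id" if "(x, y) \<in> r - Id"
    unfolding dom_cover_def using someI_ex[OF dominant[OF that]] by blast
  show "(dom_cover x, z) \<in> r - Id" if "(x, w) \<in> r - Id" "(w, z) \<in> r - Id"
    unfolding dom_cover_def using someI_ex[OF dominant[OF that(1)]] that by blast
qed

text \<open>If x < w < d, where d is the dominant cover of x, then domination would give d < d.\<close>

lemma dom_cover_covers: "(x, y) \<in> r - Id \<Longrightarrow> covered_by r x (dom_cover x)"
  using dom_cover_less dom_cover_dominates unfolding covered_by_def by blast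

lemma covered_or_above_dom_cover:
  "(x, y) \<in> r - Id \<Longrightarrow> covered_by r x y \<or> (dom_cover x, y) \<in> r - Id"
  using dom_cover_dominates unfolding covered_by_def by blast

definition up_card :: "'a \<Rightarrow> nat" where
  "up_card x = card {z. (x, z) \<in> r}"

lemma finite_up: "finite {z. (x, z) \<in> r}"
  by (rule finite_subset[OF _ finite_Field]) (auto simp: Field_def)

lemma up_card_mono: "(x, y) \<in> r \<Longrightarrow> up_card y \<le> up_card x"
  unfolding up_card_def using r_trans by (intro card_mono finite_up) blast

lemma up_card_strict: "(x, y) \<in> r - Id \<Longrightarrow> up_card y < up_card x"
  unfolding up_card_def
proof (intro psubset_card_mono finite_up psubsetI)
  assume xy: "(x, y) \<in> r - Id"
  then show "{z. (y, z) \<in> r} \<subseteq> {z. (x, z) \<in> r}" using r_trans by blast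
  have "(x, x) \<in> r" "(y, x) \<notin> r" using xy r_refl in_Field r_antisym by blast+
  then show "{z. (y, z) \<in> r} \<noteq> {z. (x, z) \<in> r}" by blast
qed

section \<open>The recursive atom ordering\<close>

lemma interval_top_iff:
  "(u, v) \<in> interval r p top \<longleftrightarrow> (u, v) \<in> r \<and> (p, u) \<in> r"
  unfolding interval_def using top_greatest in_Field r_trans by blast

lemma Field_interval_top: "Field (interval r p top) = {z. (p, z) \<in> r}"
proof
  show "Field (interval r p top) \<subseteq> {z. (p, z) \<in> r}"
    using interval_top_iff r_trans unfolding Field_def by blast
  show "{z. (p, z) \<in> r} \<subseteq> Field (interval r p top)"
    using interval_top_iff r_refl in_Field unfolding Field_def by blast
qed

lemma minimal_elt_interval:
  "p \<in> Field r \<Longrightarrow> minimal_elt (interval r p top) z \<longleftrightarrow> z = p"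
  unfolding minimal_elt_def Field_interval_top interval_top_iff
  using r_refl r_antisym by blast

lemma maximal_elt_interval:
  "p \<in> Field r \<Longrightarrow> maximal_elt (interval r p top) z \<longleftrightarrow> z = top"
  unfolding maximal_elt_def Field_interval_top interval_top_iff
  using r_antisym top_greatest in_Field by blast

lemma hat0_interval: "p \<in> Field r \<Longrightarrow> hat0 (interval r p top) = p"
  unfolding hat0_def using minimal_elt_interval by (intro the_equality) auto

lemma hat1_interval: "p \<in> Field r \<Longrightarrow> hat1 (interval r p top) = top"
  unfolding hat1_def using maximal_elt_interval by (intro the_equality) auto

lemma atoms_interval: "p \<in> Field r \<Longrightarrow> atoms (interval r p top) = {q. covered_by r p q}"
proof -
  assume p: "p \<in> Field r"
  show ?thesis
    unfolding atoms_def hat0_interval[OF p] covered_by_def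
    unfolding Diff_iff interval_top_iff using r_refl[OF p] r_trans by blast
qed

lemma interval_interval:
  "(p, q) \<in> r \<Longrightarrow> interval (interval r p top) q top = interval r q top"
proof -
  assume pq: "(p, q) \<in> r"
  have "(u, v) \<in> interval (interval r p top) q top \<longleftrightarrow> (u, v) \<in> interval r q top" for u v
  proof -
    have "(u, v) \<in> interval (interval r p top) q top \<longleftrightarrow>
        (u, v) \<in> r \<and> (p, u) \<in> r \<and> (q, u) \<in> r \<and> (u, top) \<in> r \<and> (q, v) \<in> r \<and> (v, top) \<in> r"
      unfolding interval_def[of "interval r p top"] Int_iff mem_Collect_eq mem_Sigma_iff
        interval_top_iff using pq r_trans by blast
    then show ?thesis
      unfolding interval_top_iff using pq r_trans top_greatest in_Field by blast
  qed
  then show ?thesis by auto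
qed

lemma r_eq_interval: "interval r bot top = r"
  using interval_top_iff bot_least in_Field by auto

lemma finite_bounded: "finite_bounded_poset r"
  unfolding finite_bounded_poset_def
  using finite_Field partial_order minimal_elt_interval[OF bot_in]
    maximal_elt_interval[OF bot_in] unfolding r_eq_interval by auto

end

lemma linear_order_with_first:
  assumes "d \<in> A"
  obtains L where "linear_order_on A L" and "\<And>a. a \<in> A \<Longrightarrow> (d, a) \<in> L"
proof -
  obtain W where "well_order_on (A - {d}) W" using well_order_on by blast
  then have W: "linear_order_on (A - {d}) W" by (simp add: well_order_on_def)
  have "linear_order_on A (W \<union> {d} \<times> A)"
    using W assms
    unfolding order_on_defs refl_on_def trans_def antisym_def total_on_def by blast
  then show thesis using that by blast
qed

context dominant_cover_poset
begin

text \<open>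
  The induction is on the number of elements of [p, 1]. Both conditions come down to the fact that
  every x > p' with p' > p lies above the first atom, the dominant cover of p.
\<close>

lemma recursive_atom_ordering_interval:
  "p \<in> Field r \<Longrightarrow> \<exists>L. recursive_atom_ordering (interval r p top) L"
proof (induction "up_card p" arbitrary: p rule: less_induct)
  case less
  let ?I = "interval r p top" and ?d = "dom_cover p"
  have p: "p \<in> Field r" by (rule less.prems)
  have atom_less: "(p, q) \<in> r - Id" if "q \<in> atoms ?I" for q
    using that unfolding atoms_interval[OF p] covered_by_def by blast
  have rec: "interval ?I q (hat1 ?I) = interval r q top" if "(p, q) \<in> r" for q
    using interval_interval that by (simp add: hat1_interval[OF p])
  show ?case
  proof (cases "\<exists>y. (p, y) \<in> r - Id")
    case False
    then have "atoms ?I = {}" using atom_less by blast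
    moreover have "linear_order_on {} {}" by simp
    ultimately show ?thesis
      using recursive_atom_ordering.short[of ?I "{}"] recursive_atom_ordering.long[of ?I "{}"]
      by (cases "poset_length ?I \<le> 1") auto
  next
    case True
    then have d: "(p, ?d) \<in> r - Id" "?d \<in> atoms ?I"
      using dom_cover_less dom_cover_covers unfolding atoms_interval[OF p] by blast+
    obtain L where L: "linear_order_on (atoms ?I) L" and
      first: "\<And>q. q \<in> atoms ?I \<Longrightarrow> (?d, q) \<in> L"
      using linear_order_with_first[OF d(2)] by blast
    have L_atoms: "q \<in> atoms ?I \<and> q' \<in> atoms ?I" if "(q, q') \<in> L" for q q'
      using L that unfolding order_on_defs by auto
    have d_before: "(?d, q') \<in> L - Id" if "(q, q') \<in> L - Id" for q q'
    proof -
      have "antisym L" using L unfolding order_on_defs by blast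
      then show ?thesis using L_atoms first that by (auto dest: antisymD)
    qed
    have "recursive_atom_ordering ?I L" if long: "poset_length ?I > 1"
    proof (rule recursive_atom_ordering.long[OF long L]; intro ballI allI impI)
      fix q assume q: "q \<in> atoms ?I"
      then have pq: "(p, q) \<in> r - Id" by (rule atom_less)
      then have q_in: "q \<in> Field r" using in_Field by blast
      obtain L' where L': "recursive_atom_ordering (interval r q top) L'"
        using less.hyps[OF up_card_strict[OF pq] q_in] by blast
      have all_first: "\<exists>q0. (q0, q) \<in> L - Id \<and> t \<in> Field (interval ?I q0 (hat1 ?I))"
        if "(q1, q) \<in> L - Id" "t \<in> atoms (interval ?I q (hat1 ?I))" for q1 t
      proof -
        have "(q, t) \<in> r - Id"
          using that(2) pq rec by (auto simp: atoms_interval[OF q_in] covered_by_def)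
        then have "(?d, t) \<in> r" using dom_cover_dominates[OF pq] by blast
        then show ?thesis using d_before[OF that(1)] d rec by (auto simp: Field_interval_top)
      qed
      show "\<exists>L'. recursive_atom_ordering (interval ?I q (hat1 ?I)) L' \<and>
          (\<forall>s \<in> atoms (interval ?I q (hat1 ?I)). \<forall>t \<in> atoms (interval ?I q (hat1 ?I)).
            (\<exists>q0. (q0, q) \<in> L - Id \<and> s \<in> Field (interval ?I q0 (hat1 ?I))) \<and>
            \<not> (\<exists>q0. (q0, q) \<in> L - Id \<and> t \<in> Field (interval ?I q0 (hat1 ?I))) \<longrightarrow> (s, t) \<in> L')"
      proof (intro exI[of _ L'] conjI ballI impI)
        show "recursive_atom_ordering (interval ?I q (hat1 ?I)) L'" using L' rec pq by simp
      qed (use all_first in blast)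
    next
      fix p1 p' q
      assume "(p1, p') \<in> L - Id \<and> (p1, q) \<in> ?I - Id \<and> (p', q) \<in> ?I - Id"
      then have L1: "(p1, p') \<in> L - Id" and p'q: "(p', q) \<in> r - Id"
        by (auto simp: interval_top_iff)
      then have pp': "(p, p') \<in> r - Id" using L_atoms atom_less by blast
      then have p'_in: "p' \<in> Field r" using in_Field by blast
      obtain q' where q': "covered_by r p' q'" "(q', q) \<in> r"
        using covered_or_above_dom_cover[OF p'q] dom_cover_covers[OF p'q] p'q r_refl in_Field
        by blast
      have p'q': "(p', q') \<in> r - Id" using q'(1) unfolding covered_by_def by blast
      have "(?d, q') \<in> ?I - Id" "(q', q) \<in> ?I"
        using dom_cover_dominates[OF pp' p'q'] d q'(2) r_trans[of p p' q'] pp' p'q'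
        by (simp_all add: interval_top_iff)
      moreover have "q' \<in> atoms (interval ?I p' (hat1 ?I))"
        using q'(1) rec pp' by (auto simp: atoms_interval[OF p'_in])
      ultimately show "\<exists>p'' q'. (p'', p') \<in> L - Id \<and> q' \<in> atoms (interval ?I p' (hat1 ?I)) \<and>
          (p'', q') \<in> ?I - Id \<and> (q', q) \<in> ?I"
        using d_before[OF L1] by blast
    qed
    then show ?thesis
      using recursive_atom_ordering.short[OF _ L] by (cases "poset_length ?I \<le> 1") auto
  qed
qed

lemma admits_recursive: "admits_recursive_atom_ordering r"
  unfolding admits_recursive_atom_ordering_def
  using finite_bounded recursive_atom_ordering_interval[OF bot_in] by (simp add: r_eq_interval)

section \<open>Saturated chains\<close>

inductive saturated :: "'a \<Rightarrow> 'a \<Rightarrow> 'a list \<Rightarrow> bool" where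
  single: "x \<in> Field r \<Longrightarrow> saturated x x [x]"
| step: "covered_by r x v \<Longrightarrow> saturated v y c \<Longrightarrow> saturated x y (x # c)"

lemma saturated_Cons: "saturated x y c \<Longrightarrow> \<exists>vs. c = x # vs"
  by (auto elim: saturated.cases)

lemma saturated_between: "saturated x y c \<Longrightarrow> z \<in> set c \<Longrightarrow> (x, z) \<in> r \<and> (z, y) \<in> r"
proof (induction arbitrary: z rule: saturated.induct)
  case (single x)
  then show ?case using r_refl by auto
next
  case (step x v y c)
  then have "(x, v) \<in> r" unfolding covered_by_def by blast
  moreover have "(v, y) \<in> r" using step.IH saturated_Cons[OF step.hyps(2)] by auto
  ultimately have "(x, x) \<in> r" "(x, y) \<in> r" using r_trans r_refl in_Field by blast+
  then show ?case using step \<open>(x, v) \<in> r\<close> r_trans by (metis set_ConsD)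
qed

lemma saturated_le: "saturated x y c \<Longrightarrow> (x, y) \<in> r"
  using saturated_between saturated_Cons by fastforce

lemma saturated_sorted: "saturated x y c \<Longrightarrow> sorted_wrt (\<lambda>x y. (x, y) \<in> r - Id) c"
proof (induction rule: saturated.induct)
  case (step x v y c)
  have "(x, v) \<in> r - Id" using step.hyps(1) unfolding covered_by_def by blast
  then have "\<forall>z\<in>set c. (x, z) \<in> r - Id"
    using saturated_between[OF step.hyps(2)] less_le_trans by blast
  then show ?case using step.IH by simp
qed simp

text \<open>A saturated chain cannot be refined: walk up it until it passes the new element z.\<close>

lemma saturated_maximal:
  "saturated x y c \<Longrightarrow> (x, z) \<in> r \<Longrightarrow> (z, y) \<in> r \<Longrightarrow>
    (\<And>w. w \<in> set c \<Longrightarrow> (w, z) \<in> r \<or> (z, w) \<in> r) \<Longrightarrow> z \<in> set c"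
proof (induction rule: saturated.induct)
  case (single x)
  then show ?case using r_antisym by auto
next
  case (step x v y c)
  have v: "v \<in> set c" using saturated_Cons[OF step.hyps(2)] by auto
  show ?case
  proof (cases "(v, z) \<in> r")
    case True
    then show ?thesis using step by auto
  next
    case False
    then have "(z, v) \<in> r - Id" using step.prems(3)[of v] v r_refl in_Field
      by (metis DiffI list.set_intros(2) pair_in_Id_conv)
    then show ?thesis using step.hyps(1) step.prems(1) unfolding covered_by_def by auto
  qed
qed

lemma maximal_chain_saturated:
  assumes "saturated x y c"
  shows "maximal_chain (interval r x y) c"
  unfolding maximal_chain_def
proof (intro conjI ballI impI)
  note btw = saturated_between[OF assms]
  have "sorted_wrt (\<lambda>x y. (x, y) \<in> r - Id) c" by (rule saturated_sorted[OF assms])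
  then show sorted: "sorted_wrt (\<lambda>u v. (u, v) \<in> interval r x y - Id) c"
    by (rule sorted_wrt_mono_rel[rotated]) (auto simp: interval_def btw)
  have "(u, v) \<in> interval r x y \<or> (v, u) \<in> interval r x y" if uv: "u \<in> set c" "v \<in> set c" for u v
  proof -
    obtain i j where "u = c ! i" "v = c ! j" "i < length c" "j < length c"
      using uv unfolding in_set_conv_nth by blast
    then show ?thesis
      using sorted btw[OF uv(1)] r_refl[of u] in_Field unfolding sorted_wrt_iff_nth_less
      by (cases i j rule: linorder_cases) (auto simp: interval_def)
  qed
  then show "set c \<in> Chains (interval r x y)" by (auto simp: Chains_def)
  fix C assume C: "C \<in> Chains (interval r x y)" "set c \<subseteq> C"
  have "z \<in> set c" if "z \<in> C" for z
  proof (rule saturated_maximal[OF assms])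
    show "(x, z) \<in> r" "(z, y) \<in> r" using C that by (auto simp: Chains_def interval_def)
    show "(w, z) \<in> r \<or> (z, w) \<in> r" if "w \<in> set c" for w
      using C \<open>z \<in> C\<close> that by (auto simp: Chains_def interval_def)
  qed
  then show "C = set c" using C(2) by blast
qed

lemma saturatedI:
  "c \<noteq> [] \<Longrightarrow> set c \<subseteq> Field r \<Longrightarrow> successively (covered_by r) c \<Longrightarrow> saturated (hd c) (last c) c"
proof (induction c rule: induct_list012)
  case (3 u v vs)
  then show ?case using saturated.step[of u v "last (v # vs)" "v # vs"] by simp
qed (auto intro: saturated.intros)

text \<open>
  Maximality forces the end points x and y into the chain and forbids elements strictly between
  neighbours, since all of these are comparable to every element of the chain.
\<close>

lemma saturated_if_maximal_chain:
  assumes xy: "(x, y) \<in> r" and max: "maximal_chain (interval r x y) c"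
  shows "saturated x y c"
proof -
  have srt: "sorted_wrt (\<lambda>u v. (u, v) \<in> interval r x y - Id) c"
    and ch: "set c \<in> Chains (interval r x y)"
    and mx: "\<And>C. C \<in> Chains (interval r x y) \<Longrightarrow> set c \<subseteq> C \<Longrightarrow> C = set c"
    using max unfolding maximal_chain_def by blast+
  have btw: "(x, w) \<in> r \<and> (w, y) \<in> r" if "w \<in> set c" for w
    using ch that by (auto simp: Chains_def interval_def)
  have mem: "z \<in> set c"
    if "(x, z) \<in> r" "(z, y) \<in> r" "\<And>w. w \<in> set c \<Longrightarrow> (w, z) \<in> r \<or> (z, w) \<in> r" for z
  proof -
    have "(z, z) \<in> r" using that r_refl in_Field by blast
    then have "insert z (set c) \<in> Chains (interval r x y)"
      using ch that btw unfolding Chains_def interval_def by auto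
    then show ?thesis using mx by blast
  qed
  have x: "x \<in> set c" and y: "y \<in> set c"
    using mem[of x] mem[of y] xy btw r_refl in_Field by blast+
  then have ne: "c \<noteq> []" by auto
  have "x = hd c"
  proof -
    obtain u us where c: "c = u # us" using ne by (cases c) auto
    then show ?thesis using x srt btw[of u] r_antisym by (auto simp: interval_def)
  qed
  moreover have "y = last c"
  proof -
    obtain u us where c: "c = us @ [u]" using ne by (cases c rule: rev_cases) auto
    then show ?thesis
      using y srt btw[of u] r_antisym by (auto simp: interval_def sorted_wrt_append)
  qed
  moreover have "successively (covered_by r) c"
    unfolding successively_conv_nth
  proof (intro allI impI)
    fix i assume i: "Suc i < length c"
    have less: "(c ! j, c ! k) \<in> r - Id" if "j < k" "k < length c" for j k
      using srt that unfolding sorted_wrt_iff_nth_less interval_def by auto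
    have "False" if z: "(c ! i, z) \<in> r - Id" "(z, c ! Suc i) \<in> r - Id" for z
    proof -
      have pos: "(c ! j, z) \<in> r - Id" if "j \<le> i" for j
        using that z less[of j i] i less_le_trans[of _ "c ! i" z] by (cases "j = i") auto
      have pos': "(z, c ! j) \<in> r - Id" if "i < j" "j < length c" for j
        using that z less[of "Suc i" j] less_le_trans[of z "c ! Suc i"]
        by (cases "j = Suc i") auto
      have "z \<in> set c"
      proof (rule mem)
        show "(x, z) \<in> r" "(z, y) \<in> r"
          using z btw[of "c ! i"] btw[of "c ! Suc i"] i r_trans
          by (meson DiffD1 Suc_lessD nth_mem)+
        show "(w, z) \<in> r \<or> (z, w) \<in> r" if "w \<in> set c" for w
          using that pos pos' by (metis DiffD1 in_set_conv_nth not_le)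
      qed
      then obtain j where "j < length c" "z = c ! j" by (auto simp: in_set_conv_nth)
      then show False using pos[of j] pos'[of j] by (cases "j \<le> i") auto
    qed
    then show "covered_by r (c ! i) (c ! Suc i)"
      using less[of i "Suc i"] i unfolding covered_by_def by auto
  qed
  moreover have "set c \<subseteq> Field r" using btw in_Field by blast
  ultimately show ?thesis using saturatedI ne by simp
qed

lemma maximal_chain_iff_saturated:
  "(x, y) \<in> r \<Longrightarrow> maximal_chain (interval r x y) c \<longleftrightarrow> saturated x y c"
  using maximal_chain_saturated saturated_if_maximal_chain by blast

section \<open>The labeling\<close>

fun label :: "'a \<times> 'a \<Rightarrow> int" where
  "label (u, v) = (if v = dom_cover u then - int (up_card u) else 0)"

lemma label_nonpos: "label e \<le> 0"
  by (cases e) simp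

lemma edges_simps: "edges [x] = []" "edges (x # v # vs) = (x, v) # edges (v # vs)"
  by (simp_all add: edges_def)

lemma saturated_label_ge:
  "saturated x y c \<Longrightarrow> e \<in> set (edges c) \<Longrightarrow> - int (up_card x) \<le> label e"
proof (induction rule: saturated.induct)
  case (step x v y c)
  obtain vs where c: "c = v # vs" using saturated_Cons[OF step.hyps(2)] by blast
  have "up_card v \<le> up_card x"
    using step.hyps(1) up_card_mono unfolding covered_by_def by blast
  then show ?case using step by (auto simp: c edges_simps)
qed (simp add: edges_simps)

text \<open>
  If x < y is not a cover, the increasing chain goes to the dominant cover d of x and continues with
  the increasing chain from d to y. A competitor through d is handled by induction; one through
  v \<noteq> d starts with the largest possible label 0, and it has a further edge because v \<noteq> y.
\<close>

lemma increasing_chain: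
  "(x, y) \<in> r \<Longrightarrow> \<exists>c. saturated x y c \<and> sorted_wrt (<) (map label (edges c)) \<and>
     (\<forall>c'. saturated x y c' \<and> c' \<noteq> c \<longrightarrow> \<not> sorted_wrt (<) (map label (edges c')) \<and>
        (map label (edges c), map label (edges c')) \<in> lexord {(k, l). k < l})"
proof (induction "up_card x" arbitrary: x rule: less_induct)
  case less
  have first_step: "c' = [x] \<and> x = y \<or> (\<exists>v vs. c' = x # v # vs \<and> covered_by r x v \<and>
      (x, v) \<in> r - Id \<and> (v, y) \<in> r \<and> saturated v y (v # vs))" if "saturated x y c'" for c'
    using that
  proof cases
    case (step v c)
    then obtain vs where "c = v # vs" using saturated_Cons by blast
    moreover have "(x, v) \<in> r - Id" using step(2) unfolding covered_by_def by blast
    ultimately show ?thesis using step saturated_le[OF step(3)] by blast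
  qed simp
  have unique: ?case if "saturated x y c" "sorted_wrt (<) (map label (edges c))"
      "\<And>c'. saturated x y c' \<Longrightarrow> c' = c" for c
    by (intro exI[of _ c]) (use that in blast)
  consider "x = y" | "covered_by r x y" | "(x, y) \<in> r - Id" "\<not> covered_by r x y"
    using less.prems by blast
  then show ?case
  proof cases
    case 1
    have only: "c' = [x]" if "saturated x y c'" for c'
      using first_step[OF that] 1 r_antisym by auto
    have "saturated x y [x]" using 1 less.prems in_Field saturated.single by blast
    then show ?thesis by (rule unique[OF _ _ only]) (simp_all add: edges_simps)
  next
    case 2
    have only: "c' = [x, y]" if c': "saturated x y c'" for c'
    proof -
      have "x \<noteq> y" using 2 unfolding covered_by_def by blast
      then obtain v vs where v: "c' = x # v # vs" "(x, v) \<in> r - Id" "(v, y) \<in> r"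
          "saturated v y (v # vs)"
        using first_step[OF c'] by blast
      have "v = y" using v(2,3) 2 unfolding covered_by_def by blast
      moreover have "vs = []"
      proof (cases vs)
        case (Cons w us)
        then have "(v, w) \<in> r - Id" "(w, y) \<in> r"
          using saturated_sorted[OF v(4)] saturated_between[OF v(4), of w] by auto
        then show ?thesis using \<open>v = y\<close> r_antisym by blast
      qed
      ultimately show ?thesis using v by simp
    qed
    have "saturated x y [x, y]"
      using 2 less.prems in_Field by (blast intro: saturated.intros)
    then show ?thesis by (rule unique[OF _ _ only]) (simp_all add: edges_simps)
  next
    case 3
    let ?d = "dom_cover x"
    have d: "(x, ?d) \<in> r - Id" "covered_by r x ?d" "(?d, y) \<in> r - Id"
      using 3 dom_cover_less dom_cover_covers covered_or_above_dom_cover by blast+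
    obtain c where c: "saturated ?d y c" "sorted_wrt (<) (map label (edges c))"
      and c_unique: "\<And>c'. saturated ?d y c' \<Longrightarrow> c' \<noteq> c \<Longrightarrow>
        \<not> sorted_wrt (<) (map label (edges c')) \<and>
        (map label (edges c), map label (edges c')) \<in> lexord {(k, l). k < l}"
      using less.hyps[OF up_card_strict[OF d(1)]] d(3) by blast
    obtain ws where ws: "c = ?d # ws" using saturated_Cons[OF c(1)] by blast
    have xc: "map label (edges (x # c)) = - int (up_card x) # map label (edges c)"
      by (simp add: ws edges_simps)
    have pos: "up_card ?d < up_card x" by (rule up_card_strict[OF d(1)])
    show ?thesis
    proof (intro exI[of _ "x # c"] conjI allI impI)
      show "saturated x y (x # c)" by (rule saturated.step[OF d(2) c(1)])
      show "sorted_wrt (<) (map label (edges (x # c)))"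
        using c(2) saturated_label_ge[OF c(1)] pos unfolding xc by fastforce
    next
      fix c' assume c': "saturated x y c' \<and> c' \<noteq> x # c"
      then obtain v vs where v: "c' = x # v # vs" "covered_by r x v" "saturated v y (v # vs)"
        using first_step[of c'] 3(1) by blast
      have lab: "map label (edges c') = label (x, v) # map label (edges (v # vs))"
        by (simp add: v edges_simps)
      have "\<not> sorted_wrt (<) (map label (edges c')) \<and>
        (map label (edges (x # c)), map label (edges c')) \<in> lexord {(k, l). k < l}"
      proof (cases "v = ?d")
        case True
        then have "v # vs \<noteq> c" using c' v by auto
        then show ?thesis using c_unique[of "v # vs"] v True unfolding lab xc by simp
      next
        case False
        have "v \<noteq> y" using v(2) 3(2) by blast
        then obtain w us where "vs = w # us"
          using v(3) by (cases vs) (auto elim: saturated.cases)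
        then show ?thesis
          unfolding lab xc using False pos label_nonpos[of "(v, w)"] by (simp add: edges_simps)
      qed
      then show "\<not> sorted_wrt (<) (map label (edges c'))"
        "(map label (edges (x # c)), map label (edges c')) \<in> lexord {(k, l). k < l}"
        by blast+
    qed
  qed
qed

lemma CL_labeling_label: "CL_labeling r {(k, l). k \<le> l} (\<lambda>_. label)"
proof -
  have strict: "{(k, l). k \<le> l} - Id = {(k, l :: int). k < l}" by auto
  have F: "Field {(k, l :: int). k \<le> l} = UNIV" by (auto simp: Field_def)
  have po: "partial_order_on (Field {(k, l). k \<le> l}) {(k, l :: int). k \<le> l}"
    unfolding F by (simp add: order_on_defs refl_on_def trans_def antisym_def)
  have cel: "chain_edge_labeling r {(k, l). k \<le> l} (\<lambda>_. label)"
    by (simp add: chain_edge_labeling_def F)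
  have seq: "label_seq r (\<lambda>_. label) rt c = map label (edges c)" for rt c
    by (simp add: label_seq_def)
  have lt: "(\<lambda>k l :: int. (k, l) \<in> {(k, l). k < l}) = (<)" by simp
  show ?thesis
    unfolding CL_labeling_def strict seq lt
  proof (intro conjI po cel allI impI)
    fix x y rt assume "(x, y) \<in> r \<and> maximal_chain (interval r (hat0 r) x) rt"
    then have xy: "(x, y) \<in> r" ..
    show "\<exists>c. maximal_chain (interval r x y) c \<and> sorted_wrt (<) (map label (edges c)) \<and>
        (\<forall>c'. maximal_chain (interval r x y) c' \<and> c' \<noteq> c \<longrightarrow>
          \<not> sorted_wrt (<) (map label (edges c')) \<and>
          (map label (edges c), map label (edges c')) \<in> lexord {(k, l). k < l})"
      unfolding maximal_chain_iff_saturated[OF xy] by (rule increasing_chain[OF xy])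
  qed
qed

lemma CL_shellable: "CL_shellable r"
  using CL_shellableI[OF finite_bounded CL_labeling_label] .

end

section \<open>Proper divisibility\<close>

lemma properly_divides_nth:
  "properly_divides b c \<longleftrightarrow> length b = length c \<and>
     (\<forall>i < length b. b ! i = 0 \<and> c ! i = 0 \<or> b ! i < c ! i)"
  by (simp add: properly_divides_def list_all2_conv_all_nth)

lemma properly_divides_trans:
  assumes "properly_divides b c" and "properly_divides c d"
  shows "properly_divides b d"
proof -
  have "b ! i = 0 \<and> d ! i = 0 \<or> b ! i < d ! i" if "i < length b" for i
  proof -
    have "b ! i = 0 \<and> c ! i = 0 \<or> b ! i < c ! i" "c ! i = 0 \<and> d ! i = 0 \<or> c ! i < d ! i"
      using assms that by (simp_all add: properly_divides_nth)
    then show ?thesis by linarith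
  qed
  then show ?thesis using assms by (simp add: properly_divides_nth)
qed

lemma vec_le_trans: "vec_le b c \<Longrightarrow> vec_le c d \<Longrightarrow> vec_le b d"
  unfolding vec_le_def using properly_divides_trans by blast

text \<open>Two vectors that properly divide each other are both zero.\<close>

lemma vec_le_antisym:
  assumes "vec_le b c" and "vec_le c b"
  shows "b = c"
proof (rule ccontr)
  assume ne: "b \<noteq> c"
  then have pd: "properly_divides b c" "properly_divides c b"
    using assms by (auto simp: vec_le_def)
  have "b ! i = c ! i" if "i < length b" for i
  proof -
    have "b ! i = 0 \<and> c ! i = 0 \<or> b ! i < c ! i" "c ! i = 0 \<and> b ! i = 0 \<or> c ! i < b ! i"
      using pd that by (simp_all add: properly_divides_nth)
    then show ?thesis by linarith
  qed
  moreover have "length b = length c" using pd by (simp add: properly_divides_nth)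
  ultimately show False using ne nth_equalityI by blast
qed

lemma vec_le_length: "vec_le b c \<Longrightarrow> length b = length c"
  by (auto simp: vec_le_def properly_divides_nth)

lemma zero_vec_le: "vec_le (replicate (length c) 0) c"
  by (auto simp: vec_le_def properly_divides_nth)

lemma Field_P_order: "Field (P_order a) = {b. vec_le b a}"
  by (auto simp: P_order_def Field_def vec_le_def)

lemma finite_Field_P_order: "finite (Field (P_order a))"
proof (rule finite_subset)
  show "finite {b. set b \<subseteq> {..sum_list a} \<and> length b = length a}"
    by (simp add: finite_lists_length_eq)
  have "b ! i \<le> sum_list a" if "vec_le b a" "i < length b" for b i
  proof -
    have "b ! i \<le> a ! i" "i < length a"
      using that by (auto simp: vec_le_def properly_divides_nth)
    then show ?thesis using elem_le_sum_list[of i a] by simp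
  qed
  then show "Field (P_order a) \<subseteq> {b. set b \<subseteq> {..sum_list a} \<and> length b = length a}"
    unfolding Field_P_order using vec_le_length by (auto simp: in_set_conv_nth)
qed

lemma partial_order_P_order: "partial_order_on (Field (P_order a)) (P_order a)"
proof -
  have "refl_on (Field (P_order a)) (P_order a)"
    unfolding refl_on_def Field_P_order by (simp add: P_order_def vec_le_def)
  moreover have "trans (P_order a)"
    by (rule transI) (auto simp: P_order_def intro: vec_le_trans)
  moreover have "antisym (P_order a)"
    by (rule antisymI) (auto simp: P_order_def intro: vec_le_antisym)
  moreover have "P_order a \<subseteq> Field (P_order a) \<times> Field (P_order a)"
    by (auto simp: Field_def)
  ultimately show ?thesis by (simp add: order_on_defs)
qed

text \<open>
  Proper divisors of x are componentwise at most d = x - 1, and being componentwise larger preserves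
  the property of having z as a proper divisor. Equality z = d would make w componentwise at most
  its own proper divisor z, so that both vanish.
\<close>

lemma properly_divides_decrement:
  assumes "properly_divides w x" and "properly_divides z w" and "z \<noteq> w"
  shows "properly_divides z (map (\<lambda>k. k - 1) x) \<and> z \<noteq> map (\<lambda>k. k - 1) x"
proof -
  let ?d = "map (\<lambda>k. k - 1) x"
  have len: "length z = length w" "length w = length x"
    using assms by (simp_all add: properly_divides_nth)
  have wd: "w ! i \<le> x ! i - 1" and zw: "z ! i = 0 \<and> w ! i = 0 \<or> z ! i < w ! i"
    if "i < length x" for i
  proof -
    have "w ! i = 0 \<and> x ! i = 0 \<or> w ! i < x ! i"
      using assms(1) that len by (simp add: properly_divides_nth)
    then show "w ! i \<le> x ! i - 1" by linarith
    show "z ! i = 0 \<and> w ! i = 0 \<or> z ! i < w ! i"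
      using assms(2) that len by (simp add: properly_divides_nth)
  qed
  have "z ! i = 0 \<and> x ! i - 1 = 0 \<or> z ! i < x ! i - 1" if "i < length x" for i
    using wd[OF that] zw[OF that] by linarith
  then have "properly_divides z ?d" using len by (simp add: properly_divides_nth)
  moreover have "z \<noteq> ?d"
  proof
    assume zd: "z = ?d"
    have "z ! i = w ! i" if "i < length x" for i
    proof -
      have "z ! i = x ! i - 1" using zd that by simp
      then show ?thesis using wd[OF that] zw[OF that] by linarith
    qed
    then show False using assms(3) len by (simp add: list_eq_iff_nth_eq)
  qed
  ultimately show ?thesis ..
qed

text \<open>
  The zero vector, whose decrement is itself, is excluded because it has no divisor y other than
  itself.
\<close>

lemma decrement_properly_divides:
  assumes "properly_divides y x" and "y \<noteq> x"
  shows "properly_divides (map (\<lambda>k. k - 1) x) x \<and> map (\<lambda>k. k - 1) x \<noteq> x"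
proof -
  have len: "length y = length x" using assms(1) by (simp add: properly_divides_nth)
  then obtain i where i: "i < length x" "y ! i \<noteq> x ! i"
    using assms(2) by (auto simp: list_eq_iff_nth_eq)
  have "y ! i = 0 \<and> x ! i = 0 \<or> y ! i < x ! i"
    using assms(1) i(1) len by (simp add: properly_divides_nth)
  with i have "x ! i > 0" by linarith
  then have "map (\<lambda>k. k - 1) x ! i \<noteq> x ! i" using i(1) by simp
  then have "map (\<lambda>k. k - 1) x \<noteq> x" by fastforce
  then show ?thesis by (auto simp: properly_divides_nth)
qed

lemma dominant_cover_poset_P_order:
  "dominant_cover_poset ((P_order a)\<inverse>) a (replicate (length a) 0)"
proof
  show "finite (Field ((P_order a)\<inverse>))" by (simp add: finite_Field_P_order)
  show "partial_order_on (Field ((P_order a)\<inverse>)) ((P_order a)\<inverse>)"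
    using partial_order_P_order by simp
  show "a \<in> Field ((P_order a)\<inverse>)" by (simp add: Field_P_order vec_le_def)
  show "replicate (length a) 0 \<in> Field ((P_order a)\<inverse>)"
    by (simp add: Field_P_order zero_vec_le)
next
  fix x assume "x \<in> Field ((P_order a)\<inverse>)"
  then have x: "vec_le x a" by (simp add: Field_P_order)
  then show "(a, x) \<in> (P_order a)\<inverse>" by (simp add: P_order_def vec_le_def)
  show "(x, replicate (length a) 0) \<in> (P_order a)\<inverse>"
    using x zero_vec_le[of x] zero_vec_le[of a] vec_le_length[OF x] by (simp add: P_order_def)
next
  fix x y assume xy: "(x, y) \<in> (P_order a)\<inverse> - Id"
  have less_iff: "(u, v) \<in> (P_order a)\<inverse> - Id \<longleftrightarrow> vec_le u a \<and> properly_divides v u \<and> v \<noteq> u"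
    for u v
    using vec_le_trans[of v u a] by (auto simp: P_order_def vec_le_def)
  let ?d = "map (\<lambda>k. k - 1) x"
  have "(x, ?d) \<in> (P_order a)\<inverse> - Id"
    using xy decrement_properly_divides[of y x] unfolding less_iff by blast
  moreover from this have "vec_le ?d a" by (auto simp: P_order_def)
  ultimately show "\<exists>d. (x, d) \<in> (P_order a)\<inverse> - Id \<and> (\<forall>w z. (x, w) \<in> (P_order a)\<inverse> - Id \<longrightarrow>
      (w, z) \<in> (P_order a)\<inverse> - Id \<longrightarrow> (d, z) \<in> (P_order a)\<inverse> - Id)"
    unfolding less_iff using properly_divides_decrement by (intro exI[of _ ?d]) blast
qed

theorem theorem2p2:
  fixes n :: nat and a :: "nat list"
  assumes "n \<ge> 1" and "length a = n"
  shows "admits_recursive_atom_ordering ((P_order a)\<inverse>) \<and> CL_shellable ((P_order a)\<inverse>)"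
proof -
  interpret dominant_cover_poset "(P_order a)\<inverse>" a "replicate (length a) 0"
    by (rule dominant_cover_poset_P_order)
  show ?thesis using admits_recursive CL_shellable by blast
qed

end
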